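(* Let $(U^j)_{j\ge 0}$ be a solution of the explicit scheme that blows up at time $T_{h,\lambda}$, and let $B^*(U)$ be the set of nodes $x_k$ such that $$u_k^j \sim (T_{h,\lambda}-t^j)^{- \frac{1}{p-1}} .$$ Let $K \in \{0,1,2,\dots\}$ be such that $\frac{K+2}{K+1}<p \le \frac{K+1}K$ (that is, $K$ is the integer part of $1/(p-1)$; the upper bound is void if $K=0$). Then, for every node $x_k$, $$u_k^j \to +\infty \ (j\to\infty) \qquad \iff \qquad d(k) \le K .$$ Moreover, if $d(k)\le K$, the asymptotic behaviour of $(u^j_k)_{j\ge 1}$ is given by $$u_{k}^j \sim (T_{h,\lambda}-t^j)^{-\frac{1}{p-1} + d(k) }$$ if $p \ne \frac{K+1}{K}$, and, if $p = \frac{K+1}{K}$ and $d(k) =K$, by $$u_{k}^j \sim |\ln (T_{h,\lambda} -t^j)| .$$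
   Context: Let $N\ge 1$ be an integer and $p>1$ a real number. $M=\mathrm{diag}(m_1,\dots,m_N)$ is a diagonal matrix with $m_k>0$ for all $k$. $A=(a_{ik})$ is a real symmetric positive semidefinite $N\times N$ matrix with $a_{ik}\le 0$ for $i\neq k$, $a_{ii}>0$, and $\sum_{k=1}^N a_{ik}\ge 0$ for every $i$. The indices $1,\dots,N$ correspond to nodes $x_1,\dots,x_N$ of a space discretization. All operations between vectors of $\mathbb{R}^N$ (in particular powers) are understood coordinate by coordinate. Explicit scheme: fix $\lambda>0$ and an initial vector $U^0\in\mathbb{R}^N$ with nonnegative entries, not all zero. For $j\ge 0$ write $U^j=(u_1^j,\dots,u_N^j)$, $w^j=\sum_{k=1}^N m_k u_k^j$, $\tau_j=\lambda/(w^j)^p$, $t^0=0$, $t^{j+1}=t^j+\tau_j$, and $$M U^{j+1}= M U^j + \tau_j \left (- AU^j + M (U^j)^p\right ).$$ Standing assumptions: $\lambda < \min_{1\le i \le N}\frac{m_i}{a_{ii}}(w^0)^p$, and the solutions considered have nonnegative entries with $w^j>0$ for all $j$. A solution blows up if $\lim_{j\to\infty}\|U^j\|_\infty=\infty$ and $T_{h,\lambda}:=\sum_{j=0}^\infty \tau_j<\infty$; $T_{h,\lambda}$ is its blow-up time. The notation $f(j)\sim g(j)$ means that there are constants $c,C>0$ independent of $j$ (for $j$ large) with $c\,g(j)\le f(j)\le C\,g(j)$; the constants may depend on all other data. Consider the graph whose vertices are the nodes, two different nodes $x_i,x_k$ being connected by an edge if and only if $a_{ik}\neq 0$, with its usual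 graph distance. $d(k)$ denotes the graph distance from $x_k$ to the set $B^*(U)$ ($d(k)=0$ if $x_k\in B^*(U)$, and $d(k)=\infty$ if $x_k$ cannot be joined to $B^*(U)$). *)

theory Defs
  imports "HOL-Analysis.Analysis" "HOL-Library.Extended_Nat"
begin

definition diag_mat :: "real ^ 'n \<Rightarrow> real ^ 'n ^ 'n" where
  "diag_mat m = (\<chi> i k. if i = k then m $ i else 0)"

text \<open>Coordinatewise power. It is only applied to vectors with nonnegative entries and with
  \<open>p > 1\<close>, where \<open>powr\<close> is the usual power (in particular \<open>0 powr p = 0\<close>).\<close>

definition vec_powr :: "real ^ 'n \<Rightarrow> real \<Rightarrow> real ^ 'n" where
  "vec_powr u p = (\<chi> i. u $ i powr p)"

definition admissible_matrix :: "real ^ 'n ^ 'n \<Rightarrow> bool" where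
  "admissible_matrix A \<longleftrightarrow>
     transpose A = A \<and>
     (\<forall>x. 0 \<le> x \<bullet> (A *v x)) \<and>
     (\<forall>i k. i \<noteq> k \<longrightarrow> A $ i $ k \<le> 0) \<and>
     (\<forall>i. 0 < A $ i $ i) \<and>
     (\<forall>i. 0 \<le> (\<Sum>k\<in>UNIV. A $ i $ k))"

text \<open>The quantities \<open>w\<^sup>j\<close>, \<open>\<tau>\<^sub>j\<close> and \<open>t\<^sup>j\<close> of a sequence \<open>U\<close>.\<close>

definition mass :: "real ^ 'n \<Rightarrow> (nat \<Rightarrow> real ^ 'n) \<Rightarrow> nat \<Rightarrow> real" where
  "mass m U j = (\<Sum>k\<in>UNIV. m $ k * U j $ k)"

definition time_step :: "real ^ 'n \<Rightarrow> real \<Rightarrow> real \<Rightarrow> (nat \<Rightarrow> real ^ 'n) \<Rightarrow> nat \<Rightarrow> real" where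
  "time_step m p l U j = l / mass m U j powr p"

primrec time :: "real ^ 'n \<Rightarrow> real \<Rightarrow> real \<Rightarrow> (nat \<Rightarrow> real ^ 'n) \<Rightarrow> nat \<Rightarrow> real" where
  "time m p l U 0 = 0"
| "time m p l U (Suc j) = time m p l U j + time_step m p l U j"

text \<open>Includes the standing assumptions on the solutions under consideration: nonnegative
  initial vector, not identically zero, nonnegative entries and positive mass at every step, and
  the smallness condition on \<open>l\<close> (the parameter \<open>\<lambda>\<close>).\<close>

definition explicit_solution ::
  "real ^ 'n \<Rightarrow> real ^ 'n ^ 'n \<Rightarrow> real \<Rightarrow> real \<Rightarrow> (nat \<Rightarrow> real ^ 'n) \<Rightarrow> bool" where
  "explicit_solution m A p l U \<longleftrightarrow>
     0 < l \<and>
     l < Min (range (\<lambda>i. m $ i / A $ i $ i * mass m U 0 powr p)) \<and>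
     U 0 \<noteq> 0 \<and>
     (\<forall>j k. 0 \<le> U j $ k) \<and>
     (\<forall>j. 0 < mass m U j) \<and>
     (\<forall>j. diag_mat m *v U (Suc j) =
            diag_mat m *v U j +
            time_step m p l U j *\<^sub>R (- (A *v U j) + diag_mat m *v vec_powr (U j) p))"

definition blows_up_at ::
  "real ^ 'n \<Rightarrow> real \<Rightarrow> real \<Rightarrow> (nat \<Rightarrow> real ^ 'n) \<Rightarrow> real \<Rightarrow> bool" where
  "blows_up_at m p l U T \<longleftrightarrow>
     filterlim (\<lambda>j. infnorm (U j)) at_top sequentially \<and> time_step m p l U sums T"

text \<open>The relation \<open>f(j) \<sim> g(j)\<close>. It compares up to multiplicative constants and is not the
  asymptotic equivalence \<open>\<sim>[F]\<close> of the library.\<close>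

definition same_order :: "(nat \<Rightarrow> real) \<Rightarrow> (nat \<Rightarrow> real) \<Rightarrow> bool" where
  "same_order f g \<longleftrightarrow>
     (\<exists>c>0. \<exists>C>0. \<forall>\<^sub>F j in sequentially. c * g j \<le> f j \<and> f j \<le> C * g j)"

definition blow_up_set ::
  "real ^ 'n \<Rightarrow> real \<Rightarrow> real \<Rightarrow> (nat \<Rightarrow> real ^ 'n) \<Rightarrow> real \<Rightarrow> 'n set" where
  "blow_up_set m p l U T =
     {k. same_order (\<lambda>j. U j $ k) (\<lambda>j. (T - time m p l U j) powr (- 1 / (p - 1)))}"

definition node_edges :: "real ^ 'n ^ 'n \<Rightarrow> ('n \<times> 'n) set" where
  "node_edges A = {(i, k). i \<noteq> k \<and> A $ i $ k \<noteq> 0}"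

text \<open>Graph distance as the least length of a walk; the infimum of the empty set is \<open>\<infinity>\<close>, both for
  disconnected nodes and for the distance to the empty set.\<close>

definition graph_dist :: "('a \<times> 'a) set \<Rightarrow> 'a \<Rightarrow> 'a \<Rightarrow> enat" where
  "graph_dist E x y = Inf {enat n |n. (x, y) \<in> E ^^ n}"

definition graph_dist_set :: "('a \<times> 'a) set \<Rightarrow> 'a \<Rightarrow> 'a set \<Rightarrow> enat" where
  "graph_dist_set E x S = (INF y\<in>S. graph_dist E x y)"

end

theory Submission
  imports Defs "HOL-Real_Asymp.Real_Asymp"
begin

text \<open>The proof replaces the time variable by the step number \<open>j\<close>. Since \<open>\<tau>\<^sub>j = \<lambda> / (w\<^sup>j)\<^sup>p\<close>, where \<open>\<lambda>\<close> is the
  parameter \<open>l\<close>, the reaction term adds \<open>\<lambda> (u\<^sub>k\<^sup>j / w\<^sup>j)\<^sup>p\<close> to \<open>u\<^sub>k\<close> in one step, which is bounded, while diffusion adds only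
  \<open>O((w\<^sup>j)\<^bsup>1-p\<^esup>)\<close>, which vanishes as the mass \<open>w\<^sup>j\<close> diverges. The node carrying the largest share of
  the mass keeps the total reaction above a positive constant, so \<open>w\<^sup>j\<close> grows by an amount between
  two positive constants in each step. Hence \<open>w\<^sup>j \<sim> j\<close>, \<open>\<tau>\<^sub>j \<sim> j\<^bsup>-p\<^esup>\<close> and, summing the tail,
  \<open>T - t\<^sup>j \<sim> j\<^bsup>1-p\<^esup>\<close> (\<open>w_linear\<close>, \<open>tau_order\<close>, \<open>remaining_order\<close>). In particular \<open>B\<^sup>*\<close> consists of the
  nodes at which \<open>u\<^sub>k\<^sup>j \<sim> j\<close>, and the theorem says that \<open>u\<^sub>k\<^sup>j\<close> has order \<open>j\<^bsup>1 - d(k)(p-1)\<^esup>\<close>, order \<open>ln j\<close>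
  if this exponent is zero, and is bounded if it is negative.

  Every node outside \<open>B\<^sup>*\<close> has a summable relative reaction rate. If \<open>u\<^sub>k\<^sup>j \<ge> \<epsilon> w\<^sup>j\<close> for all late \<open>j\<close>,
  then \<open>k \<in> B\<^sup>*\<close>. Otherwise \<open>u\<^sub>k\<^sup>j < \<epsilon> w\<^sup>j\<close> at some late step, and for small \<open>\<epsilon>\<close> this inequality
  persists, because the reaction then contributes less to \<open>u\<^sub>k\<close> than \<open>\<epsilon>\<close> times the growth of \<open>w\<close>
  (\<open>subcritical_outside_blow_up_set\<close>). Below this threshold \<open>u\<^sub>k\<close> grows at a relative rate
  at most \<open>\<theta> / j\<close> with \<open>\<theta> < 1\<close>, so it is \<open>O(j\<^sup>b)\<close> with \<open>b < 1\<close>, and the relative rate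
  \<open>\<tau>\<^sub>j (u\<^sub>k\<^sup>j)\<^bsup>p-1\<^esup>\<close> becomes summable (\<open>summable_reaction_outside_blow_up_set\<close>).

  By a discrete Gronwall argument only the inflow from the neighbours then matters: up to
  constants, the increment of \<open>u\<^sub>k\<^sup>j\<close> is \<open>j\<^bsup>-p\<^esup>\<close> times the values at the neighbours. If these have order
  \<open>j\<^sup>e\<close> with \<open>e > p - 1\<close>, summation gives order \<open>j\<^bsup>e-(p-1)\<^esup>\<close>, so each edge away from \<open>B\<^sup>*\<close> costs \<open>p - 1\<close> in the
  exponent. Induction on the distance gives the upper bounds (\<open>upper_bound_by_distance\<close>), and
  induction along a shortest walk to \<open>B\<^sup>*\<close> the lower bounds (\<open>lower_bound_by_walk\<close>). The number \<open>K\<close> is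
  the last distance at which the exponent is nonnegative.\<close>

section \<open>Orders of magnitude of real sequences\<close>

text \<open>For nonnegative sequences the comparison up to constants is the Landau symbol \<open>\<Theta>\<close>, which brings
  its calculus and the automation for concrete asymptotics to bear.\<close>

lemma same_order_iff_bigtheta:
  assumes "\<forall>\<^sub>F j in sequentially. 0 \<le> f j" and "\<forall>\<^sub>F j in sequentially. 0 \<le> g j"
  shows "same_order f g \<longleftrightarrow> f \<in> \<Theta>(g)"
proof
  assume "same_order f g"
  then obtain c C where c: "c > 0" "C > 0"
    and ev: "\<forall>\<^sub>F j in sequentially. c * g j \<le> f j \<and> f j \<le> C * g j"
    unfolding same_order_def by blast
  show "f \<in> \<Theta>(g)"
  proof (rule bigthetaI'[of c C])
    show "\<forall>\<^sub>F j in sequentially. c * norm (g j) \<le> norm (f j) \<and> norm (f j) \<le> C * norm (g j)"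
      using ev assms by eventually_elim auto
  qed (use c in auto)
next
  assume "f \<in> \<Theta>(g)"
  then obtain c C where c: "c > 0" "C > 0"
    and ev: "\<forall>\<^sub>F j in sequentially. norm (f j) \<ge> c * norm (g j)"
            "\<forall>\<^sub>F j in sequentially. norm (f j) \<le> C * norm (g j)"
    by (metis bigthetaD1 bigthetaD2 landau_o.bigE landau_omega.bigE)
  have "\<forall>\<^sub>F j in sequentially. c * g j \<le> f j \<and> f j \<le> C * g j"
    using ev assms by eventually_elim auto
  then show "same_order f g"
    unfolding same_order_def using c by blast
qed

lemma decreasing_null_imp_nonneg:
  fixes f :: "nat \<Rightarrow> real"
  assumes "f \<longlonglongrightarrow> 0" and "\<forall>\<^sub>F j in sequentially. f (Suc j) \<le> f j"
  shows "\<forall>\<^sub>F j in sequentially. 0 \<le> f j"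
proof -
  obtain J where J: "\<And>j. j \<ge> J \<Longrightarrow> f (Suc j) \<le> f j"
    using assms(2) unfolding eventually_sequentially by blast
  have "decseq (\<lambda>i. f (i + J))"
    by (intro decseq_SucI) (simp add: J)
  then have "0 \<le> f (i + J)" for i
    using decseq_ge[OF _ LIMSEQ_ignore_initial_segment[OF assms(1)]] by blast
  then show ?thesis
    unfolding eventually_sequentially by (metis le_add_diff_inverse2)
qed

text \<open>A sequence tending to zero is the sum of its later decrements, so the order of the decrements
  determines the order of the sequence. Indeed \<open>f - c g\<close> and \<open>C g - f\<close> are eventually
  decreasing for suitable \<open>c\<close> and \<open>C\<close>, with limit zero, hence nonnegative.\<close>

lemma bigtheta_of_null_increments:
  fixes f g :: "nat \<Rightarrow> real"
  assumes f: "f \<longlonglongrightarrow> 0" and g: "g \<longlonglongrightarrow> 0"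
    and mono: "\<forall>\<^sub>F j in sequentially. f (Suc j) \<le> f j" "\<forall>\<^sub>F j in sequentially. g (Suc j) \<le> g j"
    and incr: "(\<lambda>j. f j - f (Suc j)) \<in> \<Theta>(\<lambda>j. g j - g (Suc j))"
  shows "f \<in> \<Theta>(g)"
proof -
  have "same_order (\<lambda>j. f j - f (Suc j)) (\<lambda>j. g j - g (Suc j))"
    using incr mono by (subst same_order_iff_bigtheta) auto
  then obtain c C where c: "c > 0" "C > 0"
    and ev: "\<forall>\<^sub>F j in sequentially. c * (g j - g (Suc j)) \<le> f j - f (Suc j)
               \<and> f j - f (Suc j) \<le> C * (g j - g (Suc j))"
    unfolding same_order_def by blast
  have "\<forall>\<^sub>F j in sequentially. 0 \<le> f j - c * g j"
    using ev by (intro decreasing_null_imp_nonneg)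
      (use f g in \<open>auto intro!: tendsto_eq_intros elim!: eventually_mono simp: algebra_simps\<close>)
  moreover have "\<forall>\<^sub>F j in sequentially. 0 \<le> C * g j - f j"
    using ev by (intro decreasing_null_imp_nonneg)
      (use f g in \<open>auto intro!: tendsto_eq_intros elim!: eventually_mono simp: algebra_simps\<close>)
  ultimately have "\<forall>\<^sub>F j in sequentially. c * g j \<le> f j \<and> f j \<le> C * g j"
    by eventually_elim auto
  then have "same_order f g"
    unfolding same_order_def using c by blast
  then show ?thesis
    using decreasing_null_imp_nonneg[OF f mono(1)] decreasing_null_imp_nonneg[OF g mono(2)]
    by (simp add: same_order_iff_bigtheta)
qed

lemma eventually_decreasing_imp_bounded_above:
  fixes h :: "nat \<Rightarrow> real"
  assumes "\<forall>\<^sub>F j in sequentially. h (Suc j) \<le> h j"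
  obtains M where "M \<ge> 0" "\<forall>\<^sub>F j in sequentially. h j \<le> M"
proof -
  obtain J where J: "\<And>j. j \<ge> J \<Longrightarrow> h (Suc j) \<le> h j"
    using assms unfolding eventually_sequentially by blast
  have "h j \<le> h J" if "j \<ge> J" for j
    using that by (induction rule: dec_induct) (auto intro: order_trans[OF J])
  then have "\<forall>\<^sub>F j in sequentially. h j \<le> \<bar>h J\<bar>"
    unfolding eventually_sequentially by (meson abs_ge_self order_trans)
  then show thesis
    by (intro that) auto
qed

text \<open>Discrete Gronwall inequality: dividing \<open>f j\<close> by \<open>exp (\<Sum>i<j. a i)\<close>, which is bounded because \<open>a\<close> is
  summable, absorbs the factor \<open>1 + a j\<close> and leaves increments dominated by those of \<open>C g\<close>.\<close>

lemma bigo_by_gronwall: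
  fixes f g a :: "nat \<Rightarrow> real"
  assumes f: "\<And>j. 0 \<le> f j" and a: "\<And>j. 0 \<le> a j" "summable a"
    and C: "0 \<le> C" and g: "\<forall>\<^sub>F j in sequentially. 1 \<le> g j"
    and g_mono: "\<forall>\<^sub>F j in sequentially. g j \<le> g (Suc j)"
    and step: "\<forall>\<^sub>F j in sequentially. f (Suc j) \<le> (1 + a j) * f j + C * (g (Suc j) - g j)"
  shows "f \<in> O(g)"
proof -
  define s where "s j = (\<Sum>i<j. a i)" for j
  define y where "y j = f j * exp (- s j)" for j
  have s: "0 \<le> s j" "s j \<le> suminf a" for j
    unfolding s_def using a by (auto intro: sum_nonneg sum_le_suminf)
  have "\<forall>\<^sub>F j in sequentially. y (Suc j) - C * g (Suc j) \<le> y j - C * g j"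
    using step g_mono
  proof eventually_elim
    case (elim j)
    have "y (Suc j) \<le> ((1 + a j) * f j + C * (g (Suc j) - g j)) * exp (- s (Suc j))"
      unfolding y_def using elim by (intro mult_right_mono) auto
    also have "\<dots> = (1 + a j) * exp (- a j) * y j + C * (g (Suc j) - g j) * exp (- s (Suc j))"
      by (simp add: y_def s_def algebra_simps exp_diff exp_minus exp_add divide_simps)
    also have "\<dots> \<le> 1 * y j + C * (g (Suc j) - g j) * 1"
    proof (intro add_mono mult_mono)
      show "(1 + a j) * exp (- a j) \<le> 1"
        using exp_ge_add_one_self[of "a j"] by (simp add: exp_minus field_simps)
    qed (use s f C elim in \<open>auto simp: y_def\<close>)
    finally show ?case by (simp add: algebra_simps)
  qed
  then obtain M where M: "M \<ge> 0" "\<forall>\<^sub>F j in sequentially. y j - C * g j \<le> M"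
    by (rule eventually_decreasing_imp_bounded_above)
  have "\<forall>\<^sub>F j in sequentially. norm (f j) \<le> ((C + M) * exp (suminf a)) * norm (g j)"
    using M(2) g
  proof eventually_elim
    case (elim j)
    have "M * 1 \<le> M * g j" using M elim by (intro mult_left_mono) auto
    then have "y j \<le> (C + M) * g j" using elim by (simp add: algebra_simps)
    then have "y j * exp (s j) \<le> ((C + M) * g j) * exp (suminf a)"
      using s M C elim by (intro mult_mono) auto
    moreover have "y j * exp (s j) = f j" by (simp add: y_def exp_minus)
    ultimately show ?case using f[of j] elim by (simp add: mult_ac)
  qed
  then show ?thesis by (rule bigoI)
qed

text \<open>The lower counterpart. The integrating factor is now \<open>exp (\<Sum>i<j. 2 * a i)\<close>, because
  \<open>1 - x \<ge> exp (- 2 * x)\<close> for \<open>0 \<le> x \<le> 1/2\<close>.\<close>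

lemma bigomega_by_gronwall:
  fixes f g a :: "nat \<Rightarrow> real"
  assumes f: "\<And>j. 0 \<le> f j" and a: "\<And>j. 0 \<le> a j" "summable a"
    and c: "0 < c" and g: "filterlim g at_top sequentially"
    and g_mono: "\<forall>\<^sub>F j in sequentially. g j \<le> g (Suc j)"
    and step: "\<forall>\<^sub>F j in sequentially. f (Suc j) \<ge> (1 - a j) * f j + c * (g (Suc j) - g j)"
  shows "f \<in> \<Omega>(g)"
proof -
  define s where "s j = (\<Sum>i<j. 2 * a i)" for j
  define y where "y j = f j * exp (s j)" for j
  have s: "0 \<le> s j" "s j \<le> (\<Sum>i. 2 * a i)" for j
    unfolding s_def using a by (auto intro!: sum_nonneg sum_le_suminf summable_mult)
  have "\<forall>\<^sub>F j in sequentially. a j < 1 / 2"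
    using summable_LIMSEQ_zero[OF a(2)] by (intro order_tendstoD) auto
  then have "\<forall>\<^sub>F j in sequentially. c * g (Suc j) - y (Suc j) \<le> c * g j - y j"
    using step g_mono
  proof eventually_elim
    case (elim j)
    have "1 * y j + c * (g (Suc j) - g j) * 1
        \<le> (1 - a j) * exp (2 * a j) * y j + c * (g (Suc j) - g j) * exp (s (Suc j))"
    proof (intro add_mono mult_mono)
      have "0 \<le> a j * (1 - 2 * a j)" using a elim by (intro mult_nonneg_nonneg) auto
      then have "1 \<le> (1 - a j) * (1 + 2 * a j)" by (simp add: algebra_simps)
      also have "\<dots> \<le> (1 - a j) * exp (2 * a j)"
        using elim exp_ge_add_one_self[of "2 * a j"] by (intro mult_left_mono) auto
      finally show "1 \<le> (1 - a j) * exp (2 * a j)" .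
    qed (use s f c elim in \<open>auto simp: y_def\<close>)
    also have "\<dots> = ((1 - a j) * f j + c * (g (Suc j) - g j)) * exp (s (Suc j))"
      by (simp add: y_def s_def algebra_simps exp_add)
    also have "\<dots> \<le> y (Suc j)"
      unfolding y_def using elim by (intro mult_right_mono) auto
    finally show ?case by (simp add: algebra_simps)
  qed
  then obtain M where M: "M \<ge> 0" "\<forall>\<^sub>F j in sequentially. c * g j - y j \<le> M"
    by (rule eventually_decreasing_imp_bounded_above)
  have g_large: "\<forall>\<^sub>F j in sequentially. 2 * M / c \<le> g j"
    using g by (simp add: filterlim_at_top)
  have "\<forall>\<^sub>F j in sequentially. norm (f j) \<ge> (c / 2 * exp (- (\<Sum>i. 2 * a i))) * norm (g j)"
    using M(2) g_large
  proof eventually_elim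
    case (elim j)
    have g0: "0 \<le> g j" using elim M c by (meson divide_nonneg_pos mult_nonneg_nonneg order_trans zero_le_numeral)
    have "M \<le> c / 2 * g j" using elim c by (simp add: field_simps)
    then have "c / 2 * g j \<le> y j" using elim by (simp add: algebra_simps)
    then have "(c / 2 * g j) * exp (- (\<Sum>i. 2 * a i)) \<le> y j * exp (- s j)"
      using s c g0 f by (intro mult_mono) (auto simp: y_def)
    moreover have "y j * exp (- s j) = f j" by (simp add: y_def exp_minus)
    ultimately show ?case using f[of j] g0 by (simp add: mult_ac)
  qed
  then show ?thesis
    by (rule landau_omega.bigI[rotated]) (use c in auto)
qed

text \<open>The relative rate \<open>(b/2) / j\<close> is not summable, so the Gronwall inequality above does not apply.
  Instead a multiple of \<open>j\<^sup>b\<close> is a supersolution: its relative rate is about \<open>b / j\<close>, and the excess over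
  \<open>(b/2) / j\<close> pays for the forcing term of order \<open>j\<^bsup>b-1\<^esup>\<close>.\<close>

lemma bigo_by_subcritical_growth:
  fixes f :: "nat \<Rightarrow> real"
  assumes b: "0 < b" and C: "0 \<le> C" and f: "\<And>j. 0 \<le> f j"
    and step: "\<forall>\<^sub>F j in sequentially.
      f (Suc j) \<le> (1 + (b / 2) / real j) * f j + C * real j powr (b - 1)"
  shows "f \<in> O(\<lambda>j. real j powr b)"
proof -
  have "(\<lambda>j. (real (Suc j) powr b - real j powr b) / real j powr (b - 1)) \<longlonglongrightarrow> b"
    by real_asymp
  then have "\<forall>\<^sub>F j in sequentially. 3/4 * b < (real (Suc j) powr b - real j powr b) / real j powr (b - 1)"
    using b by (intro order_tendstoD) auto
  then have "\<forall>\<^sub>F j in sequentially. 0 < j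
      \<and> 3/4 * b < (real (Suc j) powr b - real j powr b) / real j powr (b - 1)
      \<and> f (Suc j) \<le> (1 + (b / 2) / real j) * f j + C * real j powr (b - 1)"
    using step eventually_gt_at_top[of "0::nat"] by eventually_elim auto
  then obtain J where J: "\<And>j. j \<ge> J \<Longrightarrow>
       3/4 * b < (real (Suc j) powr b - real j powr b) / real j powr (b - 1)"
     "\<And>j. j \<ge> J \<Longrightarrow> f (Suc j) \<le> (1 + (b / 2) / real j) * f j + C * real j powr (b - 1)"
     "J > 0"
    unfolding eventually_sequentially by blast
  \<comment> \<open>The first summand starts the induction, the second one pays for the forcing term.\<close>
  define M where "M = f J / real J powr b + 4 * C / b"
  have M: "M \<ge> 0" "C \<le> b / 4 * M" "f J \<le> M * real J powr b"
    using f[of J] C b J(3) by (auto simp: M_def field_simps)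
  have "f j \<le> M * real j powr b" if "j \<ge> J" for j
    using that
  proof (induction rule: dec_induct)
    case (step j)
    have j: "real j > 0" using step J by auto
    have e: "real j powr (b - 1) = real j powr b / real j"
      using j by (simp add: powr_diff)
    have "f (Suc j) \<le> (1 + (b / 2) / real j) * f j + C * real j powr (b - 1)"
      using J step by auto
    also have "\<dots> \<le> (1 + (b / 2) / real j) * (M * real j powr b) + (b / 4 * M) * real j powr (b - 1)"
      using step b M by (intro add_mono mult_mono mult_left_mono mult_right_mono) auto
    also have "\<dots> = M * (real j powr b + 3/4 * b * real j powr (b - 1))"
      by (simp add: e field_simps)
    also have "\<dots> \<le> M * real (Suc j) powr b"
    proof (intro mult_left_mono M)
      show "real j powr b + 3/4 * b * real j powr (b - 1) \<le> real (Suc j) powr b"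
        using J(1)[of j] step j by (simp add: pos_less_divide_eq)
    qed
    finally show ?case .
  qed (rule M)
  then have "\<forall>\<^sub>F j in sequentially. norm (f j) \<le> M * norm (real j powr b)"
    unfolding eventually_sequentially using f by (intro exI[of _ J]) auto
  then show ?thesis by (rule bigoI)
qed

text \<open>Up to constants, the order of magnitude of \<open>\<Sum>i<j. i\<^bsup>e-1\<^esup>\<close>. For \<open>e < 0\<close> this order is that of a
  constant; the form \<open>2 - j\<^sup>e\<close> is chosen because it still has increments of order \<open>j\<^bsup>e-1\<^esup>\<close> and
  stays at least \<open>1\<close>, so that the three cases can be treated alike.\<close>

definition growth :: "real \<Rightarrow> nat \<Rightarrow> real" where
  "growth e j = (if e > 0 then real j powr e else if e = 0 then ln (real j) else 2 - real j powr e)"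

lemma growth_zero: "growth 0 = (\<lambda>j. ln (real j))"
  by (auto simp: growth_def)

lemma growth_pos: "e > 0 \<Longrightarrow> growth e = (\<lambda>j. real j powr e)"
  by (auto simp: growth_def)

lemma growth_increment: "(\<lambda>j. growth e (Suc j) - growth e j) \<in> \<Theta>(\<lambda>j. real j powr (e - 1))"
proof -
  consider "e > 0" | "e = 0" | "e < 0" by linarith
  then show ?thesis
  proof cases
    case 1
    have "(\<lambda>j. real (Suc j) powr e - real j powr e) \<in> \<Theta>(\<lambda>j. real j powr (e - 1))"
      using 1 by real_asymp
    then show ?thesis using 1 by (simp add: growth_def)
  next
    case 2
    have "(\<lambda>j. ln (real (Suc j)) - ln (real j)) \<in> \<Theta>(\<lambda>j. real j powr (- 1))"
      by real_asymp
    then show ?thesis using 2 by (simp add: growth_def)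
  next
    case 3
    have "(\<lambda>j. real j powr e - real (Suc j) powr e) \<in> \<Theta>(\<lambda>j. real j powr (e - 1))"
      using 3 by real_asymp
    then show ?thesis using 3 by (simp add: growth_def)
  qed
qed

lemma growth_mono: "\<forall>\<^sub>F j in sequentially. growth e j \<le> growth e (Suc j)"
  using eventually_gt_at_top[of "0::nat"]
proof eventually_elim
  case (elim j)
  have "real (Suc j) powr e \<le> real j powr e" if "e < 0"
    using elim that by (intro powr_mono2') auto
  then show ?case using elim by (auto simp: growth_def intro!: powr_mono2)
qed

lemma growth_at_top: "e \<ge> 0 \<Longrightarrow> filterlim (growth e) at_top sequentially"
  unfolding growth_def by (cases "e = 0") (simp; real_asymp)+

lemma growth_negative: "e < 0 \<Longrightarrow> growth e \<in> \<Theta>(\<lambda>_. 1)"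
  unfolding growth_def by simp real_asymp

lemma growth_ge_1: "\<forall>\<^sub>F j in sequentially. 1 \<le> growth e j"
proof (cases "e \<ge> 0")
  case True
  then show ?thesis using growth_at_top[of e] by (simp add: filterlim_at_top)
next
  case False
  show ?thesis
    using eventually_gt_at_top[of "0::nat"]
  proof eventually_elim
    case (elim j)
    have "real j powr e \<le> real j powr 0"
      using elim False by (intro powr_mono) auto
    then show ?case using elim False by (simp add: growth_def)
  qed
qed

section \<open>Distance to a set of vertices\<close>

lemma le_graph_dist_set_iff:
  "enat n \<le> graph_dist_set E k S \<longleftrightarrow> (\<forall>y\<in>S. \<forall>l. (k, y) \<in> E ^^ l \<longrightarrow> n \<le> l)"
  unfolding graph_dist_set_def graph_dist_def
  by (fastforce simp: le_INF_iff le_Inf_iff)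

lemma graph_dist_set_neighbour:
  assumes "(k, i) \<in> E" and "enat (Suc n) \<le> graph_dist_set E k S"
  shows "enat n \<le> graph_dist_set E i S"
  using assms unfolding le_graph_dist_set_iff by (meson Suc_le_mono relpow_Suc_I2)

lemma notin_if_pos_graph_dist_set:
  assumes "enat (Suc n) \<le> graph_dist_set E k S"
  shows "k \<notin> S"
  using assms unfolding le_graph_dist_set_iff by (metis not_less_eq_eq relpow_0_I le0)

lemma graph_dist_set_walk:
  assumes "graph_dist_set E k S = enat n"
  obtains y where "y \<in> S" "(k, y) \<in> E ^^ n"
proof -
  have "\<not> enat (Suc n) \<le> graph_dist_set E k S" and "enat n \<le> graph_dist_set E k S"
    using assms by auto
  then show thesis
    unfolding le_graph_dist_set_iff by (metis le_antisym not_less_eq_eq that)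
qed

section \<open>One step of the scheme\<close>

locale blow_up_solution =
  fixes m :: "real ^ 'n" and A :: "real ^ 'n ^ 'n" and p l T :: real
    and U :: "nat \<Rightarrow> real ^ 'n"
  assumes p: "1 < p" and m_pos: "\<And>k. 0 < m $ k" and admissible: "admissible_matrix A"
    and solution: "explicit_solution m A p l U" and blows_up: "blows_up_at m p l U T"
begin

abbreviation "w \<equiv> mass m U"
abbreviation "\<tau> \<equiv> time_step m p l U"
abbreviation "remaining j \<equiv> T - time m p l U j"
abbreviation "E \<equiv> node_edges A"
abbreviation "B \<equiv> blow_up_set m p l U T"

lemma l_pos: "0 < l" and U_nonneg: "0 \<le> U j $ k" and w_pos: "0 < w j"
  using solution unfolding explicit_solution_def by auto

lemma tau_pos: "0 < \<tau> j"
  using l_pos w_pos[of j] by (simp add: time_step_def)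

lemma U_step:
  "U (Suc j) $ k = U j $ k + \<tau> j * (U j $ k powr p - (\<Sum>i\<in>UNIV. A $ k $ i * U j $ i) / m $ k)"
proof -
  have diag: "(diag_mat m *v x) $ k = m $ k * x $ k" for x :: "real ^ 'n"
  proof -
    have "(diag_mat m *v x) $ k = (\<Sum>i\<in>UNIV. if k = i then m $ k * x $ i else 0)"
      unfolding diag_mat_def matrix_vector_mult_def vec_lambda_beta
      by (intro sum.cong) auto
    then show ?thesis by simp
  qed
  have "(diag_mat m *v U (Suc j)) $ k =
     (diag_mat m *v U j + \<tau> j *\<^sub>R (- (A *v U j) + diag_mat m *v vec_powr (U j) p)) $ k"
    using solution unfolding explicit_solution_def by metis
  then have "m $ k * U (Suc j) $ k = m $ k * U j $ k
      + \<tau> j * (m $ k * U j $ k powr p - (\<Sum>i\<in>UNIV. A $ k $ i * U j $ i))"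
    by (simp add: diag) (simp add: matrix_vector_mult_def vec_powr_def)
  then have "m $ k * U (Suc j) $ k = m $ k * (U j $ k
      + \<tau> j * (U j $ k powr p - (\<Sum>i\<in>UNIV. A $ k $ i * U j $ i) / m $ k))"
    using m_pos[of k] by (simp add: algebra_simps)
  then show ?thesis
    using m_pos[of k] by simp
qed

lemma mU_le_w: "m $ k * U j $ k \<le> w j"
  unfolding mass_def
  by (rule member_le_sum) (use m_pos U_nonneg in \<open>auto intro: mult_nonneg_nonneg less_imp_le\<close>)

text \<open>Since all entries are nonnegative, the mass controls every norm of \<open>U\<close>.\<close>

lemma sum_U_le_w:
  obtains C where "C > 0" and "\<And>j. (\<Sum>k\<in>UNIV. U j $ k) \<le> C * w j"
proof -
  have "(\<Sum>k\<in>UNIV. U j $ k) \<le> (\<Sum>k\<in>UNIV. 1 / m $ k) * w j" for j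
    unfolding sum_distrib_right
    by (rule sum_mono) (use mU_le_w m_pos in \<open>auto simp: field_simps\<close>)
  moreover have "(\<Sum>k\<in>UNIV. 1 / m $ k) > 0"
    using m_pos by (intro sum_pos) auto
  ultimately show thesis by (rule that[rotated])
qed

lemma U_le_w:
  obtains C where "C > 0" and "\<And>j k. U j $ k \<le> C * w j"
proof -
  obtain C where C: "C > 0" "\<And>j. (\<Sum>k\<in>UNIV. U j $ k) \<le> C * w j"
    by (rule sum_U_le_w) blast
  have "U j $ k \<le> (\<Sum>k\<in>UNIV. U j $ k)" for j k
    by (rule member_le_sum) (use U_nonneg in auto)
  then show thesis
    using C by (meson order_trans that)
qed

lemma U_bigo_w: "(\<lambda>j. U j $ k) \<in> O(w)"
proof -
  obtain C where "\<And>j k. U j $ k \<le> C * w j"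
    by (rule U_le_w) blast
  then show ?thesis
    using U_nonneg w_pos by (intro bigoI[of _ C]) (simp add: abs_of_pos)
qed

lemma diffusion_le_w:
  obtains C where "C > 0" and "\<And>j k. \<bar>\<Sum>i\<in>UNIV. A $ k $ i * U j $ i\<bar> \<le> C * w j"
proof -
  obtain C where C: "C > 0" "\<And>j k. U j $ k \<le> C * w j"
    by (rule U_le_w) blast
  let ?D = "1 + (\<Sum>k\<in>UNIV. \<Sum>i\<in>UNIV. \<bar>A $ k $ i\<bar>)"
  have D: "?D > 0" by (smt (verit) sum_nonneg abs_ge_zero)
  have "\<bar>\<Sum>i\<in>UNIV. A $ k $ i * U j $ i\<bar> \<le> (?D * C) * w j" for j k
  proof -
    have "\<bar>\<Sum>i\<in>UNIV. A $ k $ i * U j $ i\<bar> \<le> (\<Sum>i\<in>UNIV. \<bar>A $ k $ i\<bar> * (C * w j))"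
      by (rule order_trans[OF sum_abs sum_mono])
        (use C U_nonneg in \<open>auto simp: abs_mult intro!: mult_left_mono\<close>)
    also have "\<dots> = (\<Sum>i\<in>UNIV. \<bar>A $ k $ i\<bar>) * (C * w j)"
      by (simp add: sum_distrib_right)
    also have "\<dots> \<le> ?D * (C * w j)"
    proof (rule mult_right_mono)
      have "(\<Sum>i\<in>UNIV. \<bar>A $ k $ i\<bar>) \<le> (\<Sum>k\<in>UNIV. \<Sum>i\<in>UNIV. \<bar>A $ k $ i\<bar>)"
        by (rule member_le_sum[of k UNIV "\<lambda>k. \<Sum>i\<in>UNIV. \<bar>A $ k $ i\<bar>"]) (auto intro: sum_nonneg)
      then show "(\<Sum>i\<in>UNIV. \<bar>A $ k $ i\<bar>) \<le> ?D" by simp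
    qed (use C w_pos[of j] in auto)
    finally show ?thesis by (simp add: mult_ac)
  qed
  then show thesis
    using C D by (intro that[of "?D * C"]) auto
qed

lemma w_at_top: "filterlim w at_top sequentially"
proof -
  obtain C where C: "C > 0" "\<And>j. (\<Sum>k\<in>UNIV. U j $ k) \<le> C * w j"
    by (rule sum_U_le_w) blast
  have "infnorm (U j) / C \<le> w j" for j
  proof -
    have "infnorm (U j) \<le> norm (U j)" by (rule infnorm_le_norm)
    also have "\<dots> \<le> (\<Sum>k\<in>UNIV. \<bar>U j $ k\<bar>)" by (rule norm_le_l1_cart)
    also have "\<dots> = (\<Sum>k\<in>UNIV. U j $ k)" using U_nonneg by simp
    finally show ?thesis using C(2)[of j] C(1) by (simp add: field_simps)
  qed
  moreover have "filterlim (\<lambda>j. infnorm (U j) / C) at_top sequentially"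
    using blows_up C(1) unfolding blows_up_at_def
    by (intro filterlim_at_top_mult_tendsto_pos[of "\<lambda>_. 1 / C" "1 / C", simplified]) auto
  ultimately show ?thesis
    by (rule filterlim_at_top_mono[rotated, OF always_eventually[OF allI]])
qed

lemma w_powr_null: "((\<lambda>j. w j powr (1 - p)) \<longlongrightarrow> 0) sequentially"
  using tendsto_neg_powr[OF _ w_at_top, of "1 - p"] p by simp

lemma w_powr_null_le: "0 < c \<Longrightarrow> \<forall>\<^sub>F j in sequentially. C * w j powr (1 - p) < c"
  using tendsto_mult[OF tendsto_const w_powr_null, of C] by (intro order_tendstoD(2)) auto

lemma tau_w: "\<tau> j * w j = l * w j powr (1 - p)"
  using w_pos[of j] by (simp add: time_step_def powr_diff)

lemma tau_U_powr: "\<tau> j * U j $ k powr p = l * (U j $ k / w j) powr p"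
  using w_pos[of j] U_nonneg[of j k] by (simp add: time_step_def powr_divide)

lemma w_step:
  "w (Suc j) = w j + l * (\<Sum>k\<in>UNIV. m $ k * (U j $ k / w j) powr p)
     - \<tau> j * (\<Sum>k\<in>UNIV. \<Sum>i\<in>UNIV. A $ k $ i * U j $ i)"
proof -
  have "w (Suc j) = (\<Sum>k\<in>UNIV. m $ k * U j $ k + m $ k * (\<tau> j * U j $ k powr p)
           - \<tau> j * (\<Sum>i\<in>UNIV. A $ k $ i * U j $ i))"
    unfolding mass_def using m_pos
    by (intro sum.cong refl) (simp add: U_step field_simps less_imp_neq[OF m_pos, symmetric])
  then show ?thesis
    by (simp add: tau_U_powr mass_def sum.distrib sum_subtractf sum_distrib_left mult_ac)
qed

text \<open>Some node carries at least the fraction \<open>1 / N\<close> of the mass, and its reaction alone gives the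
  bound. The constant is a minimum over all nodes because this node may change with \<open>j\<close>.\<close>

lemma reaction_lower:
  obtains c where "c > 0" and "\<And>j. c \<le> (\<Sum>k\<in>UNIV. m $ k * (U j $ k / w j) powr p)"
proof -
  let ?N = "real CARD('n)"
  let ?c = "\<lambda>k. m $ k * (1 / (?N * m $ k)) powr p"
  define c where "c = Min (range ?c)"
  have "?c k > 0" for k using m_pos[of k] by simp
  then have c: "c > 0" by (simp add: c_def)
  have "c \<le> (\<Sum>k\<in>UNIV. m $ k * (U j $ k / w j) powr p)" for j
  proof -
    have "\<exists>k. w j / ?N \<le> m $ k * U j $ k"
    proof (rule ccontr)
      assume "\<nexists>k. w j / ?N \<le> m $ k * U j $ k"
      then have "(\<Sum>k\<in>UNIV. m $ k * U j $ k) < (\<Sum>k\<in>(UNIV :: 'n set). w j / ?N)"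
        by (intro sum_strict_mono) (auto simp: not_le)
      then show False by (simp add: mass_def)
    qed
    then obtain k where k: "w j / ?N \<le> m $ k * U j $ k" by blast
    then have "1 / (?N * m $ k) \<le> U j $ k / w j"
      using m_pos[of k] w_pos[of j] by (simp add: field_simps)
    then have "?c k \<le> m $ k * (U j $ k / w j) powr p"
      using m_pos[of k] p by (intro mult_left_mono powr_mono2) auto
    also have "\<dots> \<le> (\<Sum>k\<in>UNIV. m $ k * (U j $ k / w j) powr p)"
      by (rule member_le_sum) (auto intro!: mult_nonneg_nonneg less_imp_le[OF m_pos])
    finally have "?c k \<le> \<dots>" .
    moreover have "c \<le> ?c k" by (simp add: c_def)
    ultimately show ?thesis by linarith
  qed
  then show thesis using c that by blast
qed

section \<open>Linear growth of the mass and the time to blow-up\<close>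

text \<open>The reaction part of the increment of the mass lies between positive constants, and the
  diffusion part tends to zero because \<open>w\<^sup>j\<close> diverges and \<open>p > 1\<close>.\<close>

lemma w_increment_bounds:
  obtains c C where "0 < c" "0 < C"
    and "\<forall>\<^sub>F j in sequentially. w j + c \<le> w (Suc j) \<and> w (Suc j) \<le> w j + C"
proof -
  obtain c where c: "c > 0" "\<And>j. c \<le> (\<Sum>k\<in>UNIV. m $ k * (U j $ k / w j) powr p)"
    by (rule reaction_lower) blast
  obtain D where D: "D > 0" "\<And>j k. U j $ k \<le> D * w j"
    by (rule U_le_w) blast
  obtain F where F: "F > 0" "\<And>j k. \<bar>\<Sum>i\<in>UNIV. A $ k $ i * U j $ i\<bar> \<le> F * w j"
    by (rule diffusion_le_w) blast
  let ?N = "real CARD('n)" and ?R = "\<Sum>k\<in>UNIV. m $ k * D powr p"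
  have R: "(\<Sum>k\<in>UNIV. m $ k * (U j $ k / w j) powr p) \<le> ?R" for j
    using D(2) m_pos w_pos p U_nonneg
    by (intro sum_mono mult_left_mono powr_mono2) (auto simp: field_simps less_imp_le)
  have R0: "?R \<ge> 0" using m_pos by (intro sum_nonneg) (auto simp: less_imp_le)
  have diffusion: "\<bar>\<tau> j * (\<Sum>k\<in>UNIV. \<Sum>i\<in>UNIV. A $ k $ i * U j $ i)\<bar>
       \<le> ?N * F * l * w j powr (1 - p)" for j
  proof -
    have "\<bar>\<Sum>k\<in>UNIV. \<Sum>i\<in>UNIV. A $ k $ i * U j $ i\<bar> \<le> (\<Sum>k\<in>(UNIV :: 'n set). F * w j)"
      by (rule order_trans[OF sum_abs sum_mono]) (rule F)
    then have "\<tau> j * \<bar>\<Sum>k\<in>UNIV. \<Sum>i\<in>UNIV. A $ k $ i * U j $ i\<bar> \<le> \<tau> j * (?N * F * w j)"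
      using tau_pos[of j] by (intro mult_left_mono) auto
    also have "\<dots> = ?N * F * (\<tau> j * w j)" by simp
    also have "\<dots> = ?N * F * l * w j powr (1 - p)" by (simp add: tau_w)
    finally show ?thesis
      using tau_pos[of j] by (simp add: abs_mult)
  qed
  have small: "\<forall>\<^sub>F j in sequentially. ?N * F * l * w j powr (1 - p) < l * c / 2"
    using c l_pos by (intro w_powr_null_le) auto
  have "\<forall>\<^sub>F j in sequentially. w j + l * c / 2 \<le> w (Suc j) \<and> w (Suc j) \<le> w j + (l * ?R + l * c / 2)"
    using small
  proof eventually_elim
    case (elim j)
    have "l * c \<le> l * (\<Sum>k\<in>UNIV. m $ k * (U j $ k / w j) powr p)"
         "l * (\<Sum>k\<in>UNIV. m $ k * (U j $ k / w j) powr p) \<le> l * ?R"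
      using c R l_pos by auto
    then show ?case
      using elim diffusion[of j] w_step[of j] by linarith
  qed
  then show thesis
    using c l_pos R0 by (intro that[of "l * c / 2" "l * ?R + l * c / 2"]) (auto intro: add_nonneg_pos)
qed

lemma w_linear: "w \<in> \<Theta>(\<lambda>j. real j)"
proof -
  obtain c C where cC: "0 < c" "0 < C"
    and ev: "\<forall>\<^sub>F j in sequentially. w j + c \<le> w (Suc j) \<and> w (Suc j) \<le> w j + C"
    by (rule w_increment_bounds)
  have "w \<in> O(\<lambda>j. real j)"
    by (rule bigo_by_gronwall[where a = "\<lambda>_. 0" and C = C])
      (use ev cC w_pos eventually_ge_at_top[of "1::nat"] in \<open>auto elim!: eventually_mono simp: less_imp_le\<close>)
  moreover have "w \<in> \<Omega>(\<lambda>j. real j)"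
    by (rule bigomega_by_gronwall[where a = "\<lambda>_. 0" and c = c])
      (use ev cC w_pos filterlim_real_sequentially in \<open>auto elim!: eventually_mono simp: less_imp_le\<close>)
  ultimately show ?thesis by (simp add: bigtheta_def)
qed

lemma w_powr: "(\<lambda>j. w j powr a) \<in> \<Theta>(\<lambda>j. real j powr a)"
  using bigtheta_powr[OF w_linear, of a] w_pos by (simp add: abs_of_pos)

lemma tau_order: "\<tau> \<in> \<Theta>(\<lambda>j. real j powr (- p))"
proof -
  have "\<tau> = (\<lambda>j. l * w j powr (- p))"
    by (auto simp: time_step_def powr_minus_divide)
  then show ?thesis
    using w_powr[of "- p"] l_pos by simp
qed

lemma time_eq: "time m p l U j = (\<Sum>i<j. \<tau> i)"
  by (induction j) auto

lemma remaining_null: "remaining \<longlonglongrightarrow> 0"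
  using blows_up unfolding blows_up_at_def sums_def time_eq[symmetric]
  by (auto intro!: tendsto_eq_intros)

lemma remaining_pos: "0 < remaining j"
proof -
  have "\<tau> sums T" using blows_up unfolding blows_up_at_def by blast
  then have "(\<Sum>i<j. \<tau> i) < T"
    using sum_less_suminf[of \<tau> j] tau_pos by (simp add: sums_iff)
  then show ?thesis by (simp add: time_eq)
qed

lemma remaining_order: "remaining \<in> \<Theta>(\<lambda>j. real j powr (1 - p))"
proof (rule bigtheta_of_null_increments)
  show "(\<lambda>j. real j powr (1 - p)) \<longlonglongrightarrow> 0" using p by real_asymp
  show "\<forall>\<^sub>F j in sequentially. remaining (Suc j) \<le> remaining j"
    using tau_pos by (auto simp: less_imp_le)
  show "\<forall>\<^sub>F j in sequentially. real (Suc j) powr (1 - p) \<le> real j powr (1 - p)"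
    using eventually_gt_at_top[of "0::nat"]
    by eventually_elim (use p in \<open>auto intro!: powr_mono2'\<close>)
  have "(\<lambda>j. real j powr (1 - p) - real (Suc j) powr (1 - p)) \<in> \<Theta>(\<lambda>j. real j powr (- p))"
    using p by real_asymp
  then have "\<tau> \<in> \<Theta>(\<lambda>j. real j powr (1 - p) - real (Suc j) powr (1 - p))"
    using tau_order bigtheta_sym landau_theta.trans by blast
  then show "(\<lambda>j. remaining j - remaining (Suc j))
      \<in> \<Theta>(\<lambda>j. real j powr (1 - p) - real (Suc j) powr (1 - p))"
    by simp
qed (rule remaining_null)

lemma remaining_powr: "(\<lambda>j. remaining j powr a) \<in> \<Theta>(\<lambda>j. real j powr ((1 - p) * a))"
  using bigtheta_powr[OF remaining_order, of a] remaining_pos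
  by (simp add: abs_of_pos powr_powr)

lemma ln_remaining: "(\<lambda>j. \<bar>ln (remaining j)\<bar>) \<in> \<Theta>(\<lambda>j. ln (real j))"
proof -
  obtain c C where c: "c > 0" "C > 0"
    and ev: "\<forall>\<^sub>F j in sequentially. c * real j powr (1 - p) \<le> remaining j
               \<and> remaining j \<le> C * real j powr (1 - p)"
    using remaining_order remaining_pos
    by (subst (asm) same_order_iff_bigtheta[symmetric]) (auto simp: less_imp_le same_order_def)
  let ?M = "\<bar>ln c\<bar> + \<bar>ln C\<bar>"
  have large: "\<forall>\<^sub>F j in sequentially. 2 * ?M / (p - 1) \<le> ln (real j)"
    using growth_at_top[of 0] unfolding filterlim_at_top growth_def by simp
  have "\<forall>\<^sub>F j in sequentially. (p - 1) / 2 * norm (ln (real j)) \<le> norm \<bar>ln (remaining j)\<bar>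
           \<and> norm \<bar>ln (remaining j)\<bar> \<le> (3/2 * (p - 1)) * norm (ln (real j))"
    using ev large eventually_gt_at_top[of "0::nat"]
  proof eventually_elim
    case (elim j)
    have j: "real j powr (1 - p) > 0" using elim by auto
    have "ln (c * real j powr (1 - p)) \<le> ln (remaining j)"
         "ln (remaining j) \<le> ln (C * real j powr (1 - p))"
      using elim c j remaining_pos[of j] by (auto intro!: ln_mono)
    then have "ln c - (p - 1) * ln (real j) \<le> ln (remaining j)"
         "ln (remaining j) \<le> ln C - (p - 1) * ln (real j)"
      using elim c by (auto simp: ln_mult ln_powr algebra_simps)
    moreover have "?M \<le> (p - 1) / 2 * ln (real j)"
      using elim p by (simp add: field_simps)
    moreover have "0 \<le> ln (real j)" using elim by auto
    ultimately show ?case by (auto simp: algebra_simps)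
  qed
  then show ?thesis
    by (intro bigthetaI'[of "(p - 1) / 2" "3/2 * (p - 1)"]) (use p in auto)
qed

lemma same_order_U_iff:
  assumes "g \<in> \<Theta>(h)" and "\<And>j. 0 \<le> g j"
  shows "same_order (\<lambda>j. U j $ k) g \<longleftrightarrow> (\<lambda>j. U j $ k) \<in> \<Theta>(h)"
  using assms U_nonneg
  by (auto simp: same_order_iff_bigtheta dest: landau_theta.trans bigtheta_sym[THEN iffD1])

lemma mem_blow_up_set_iff: "k \<in> B \<longleftrightarrow> (\<lambda>j. U j $ k) \<in> \<Theta>(\<lambda>j. real j)"
proof -
  have "(\<lambda>j. remaining j powr (- 1 / (p - 1))) \<in> \<Theta>(\<lambda>j. real j powr ((1 - p) * (- 1 / (p - 1))))"
    by (rule remaining_powr)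
  also have "(1 - p) * (- 1 / (p - 1)) = 1" using p by (simp add: field_simps)
  finally show ?thesis
    unfolding blow_up_set_def by (simp add: same_order_U_iff)
qed

section \<open>Nodes outside the blow-up set\<close>

lemma U_step_le:
  obtains C where "C > 0"
    and "\<And>j k. U (Suc j) $ k \<le> U j $ k + l * (U j $ k / w j) powr p + C * w j powr (1 - p)"
proof -
  obtain F where F: "F > 0" "\<And>j k. \<bar>\<Sum>i\<in>UNIV. A $ k $ i * U j $ i\<bar> \<le> F * w j"
    by (rule diffusion_le_w) blast
  define \<mu> where "\<mu> = Min (range (\<lambda>k. m $ k))"
  have \<mu>: "0 < \<mu>" "\<And>k. \<mu> \<le> m $ k" using m_pos by (auto simp: \<mu>_def)
  have "U (Suc j) $ k \<le> U j $ k + l * (U j $ k / w j) powr p + (F * l / \<mu>) * w j powr (1 - p)" for j k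
  proof -
    have "- (\<Sum>i\<in>UNIV. A $ k $ i * U j $ i) / m $ k \<le> \<bar>\<Sum>i\<in>UNIV. A $ k $ i * U j $ i\<bar> / m $ k"
      using m_pos[of k] by (intro divide_right_mono) auto
    also have "\<dots> \<le> (F * w j) / \<mu>"
      using F \<mu> w_pos[of j] by (intro frac_le) auto
    finally have "\<tau> j * (- (\<Sum>i\<in>UNIV. A $ k $ i * U j $ i) / m $ k) \<le> \<tau> j * ((F * w j) / \<mu>)"
      using tau_pos[of j] by (intro mult_left_mono) auto
    also have "\<dots> = (F / \<mu>) * (\<tau> j * w j)" by simp
    also have "\<dots> = (F * l / \<mu>) * w j powr (1 - p)" by (simp add: tau_w)
    finally show ?thesis
      using tau_U_powr[of j k] by (simp add: U_step algebra_simps)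
  qed
  then show thesis
    using F \<mu> l_pos by (intro that[of "F * l / \<mu>"]) auto
qed

text \<open>If \<open>U j $ k < \<epsilon> * w j\<close>, then the reaction and, for late \<open>j\<close>, the diffusion add at most \<open>\<epsilon> * \<delta>\<close> each
  to \<open>U j $ k\<close>, whereas \<open>\<epsilon> * w j\<close> grows by at least \<open>2 * \<epsilon> * \<delta>\<close>; so the inequality is preserved. It must
  hold at some late step, since otherwise \<open>U j $ k\<close> would have the order of the mass.\<close>

lemma subcritical_outside_blow_up_set:
  assumes "k \<notin> B" and "0 < \<epsilon>" and small: "\<epsilon> powr (p - 1) \<le> \<delta> / l" and "0 < \<delta>"
    and \<delta>: "\<forall>\<^sub>F j in sequentially. w j + 2 * \<delta> \<le> w (Suc j)"
  shows "\<forall>\<^sub>F j in sequentially. U j $ k < \<epsilon> * w j"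
proof -
  obtain C where C: "C > 0"
    "\<And>j k. U (Suc j) $ k \<le> U j $ k + l * (U j $ k / w j) powr p + C * w j powr (1 - p)"
    by (rule U_step_le) blast
  obtain J where J: "\<And>j. j \<ge> J \<Longrightarrow> w j + 2 * \<delta> \<le> w (Suc j)"
      "\<And>j. j \<ge> J \<Longrightarrow> C * w j powr (1 - p) < \<epsilon> * \<delta>"
    using eventually_conj[OF \<delta> w_powr_null_le[of "\<epsilon> * \<delta>" C]] assms
    unfolding eventually_sequentially by (metis mult_pos_pos)
  have preserved: "U (Suc j) $ k < \<epsilon> * w (Suc j)" if "j \<ge> J" "U j $ k < \<epsilon> * w j" for j
  proof -
    have "(U j $ k / w j) powr p \<le> \<epsilon> powr p"
      using that w_pos[of j] U_nonneg[of j k] p by (intro powr_mono2) (auto simp: field_simps)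
    also have "\<epsilon> powr p = \<epsilon> powr (p - 1) * \<epsilon>"
      using \<open>0 < \<epsilon>\<close> by (simp add: powr_diff)
    also have "\<dots> \<le> \<delta> / l * \<epsilon>"
      using small \<open>0 < \<epsilon>\<close> by (intro mult_right_mono) auto
    finally have "l * (U j $ k / w j) powr p \<le> \<epsilon> * \<delta>"
      using l_pos by (simp add: field_simps)
    then have "U (Suc j) $ k < \<epsilon> * w j + \<epsilon> * \<delta> + \<epsilon> * \<delta>"
      using C(2)[of j k] J(2)[of j] that by linarith
    also have "\<dots> = \<epsilon> * (w j + 2 * \<delta>)" by (simp add: algebra_simps)
    also have "\<dots> \<le> \<epsilon> * w (Suc j)"
      using J(1)[of j] that \<open>0 < \<epsilon>\<close> by (intro mult_left_mono) auto
    finally show ?thesis .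
  qed
  have "\<exists>j\<ge>J. U j $ k < \<epsilon> * w j"
  proof (rule ccontr)
    assume "\<not> (\<exists>j\<ge>J. U j $ k < \<epsilon> * w j)"
    then have "\<forall>\<^sub>F j in sequentially. norm (U j $ k) \<ge> \<epsilon> * norm (w j)"
      unfolding eventually_sequentially using U_nonneg w_pos
      by (intro exI[of _ J]) (auto simp: not_less abs_of_pos)
    then have "(\<lambda>j. U j $ k) \<in> \<Omega>(w)"
      using \<open>0 < \<epsilon>\<close> by (rule landau_omega.bigI[rotated])
    then have "(\<lambda>j. U j $ k) \<in> \<Theta>(\<lambda>j. real j)"
      using U_bigo_w w_linear by (meson bigthetaI landau_theta.trans)
    then show False
      using \<open>k \<notin> B\<close> by (simp add: mem_blow_up_set_iff)
  qed
  then obtain j\<^sub>0 where j0: "j\<^sub>0 \<ge> J" "U j\<^sub>0 $ k < \<epsilon> * w j\<^sub>0" by blast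
  have "U j $ k < \<epsilon> * w j" if "j \<ge> j\<^sub>0" for j
    using that by (induction rule: dec_induct) (use j0 preserved in auto)
  then show ?thesis
    unfolding eventually_sequentially by blast
qed

text \<open>Below a small fraction \<open>\<epsilon>\<close> of the mass, the reaction at node \<open>k\<close> is at most \<open>\<delta> / w\<^sup>j\<close> times \<open>u\<^sub>k\<^sup>j\<close>. As
  \<open>w\<^sup>j \<ge> \<gamma> j\<close>, this is a relative rate at most \<open>(\<delta> / \<gamma>) / j\<close>, and \<open>\<delta>\<close> can be taken as small as desired.
  Any \<open>b\<close> in \<open>(0, 1)\<close> with \<open>b \<ge> 2 - p\<close> works: the last condition makes the diffusion \<open>O(j\<^bsup>1-p\<^esup>)\<close>
  admissible as a forcing term.\<close>

lemma sublinear_outside_blow_up_set: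
  assumes "k \<notin> B"
  obtains b where "0 < b" "b < 1" "(\<lambda>j. U j $ k) \<in> O(\<lambda>j. real j powr b)"
proof -
  obtain C where C: "C > 0"
    "\<And>j k. U (Suc j) $ k \<le> U j $ k + l * (U j $ k / w j) powr p + C * w j powr (1 - p)"
    by (rule U_step_le) blast
  obtain c where c: "0 < c" and c_incr: "\<forall>\<^sub>F j in sequentially. w j + c \<le> w (Suc j)"
    by (rule w_increment_bounds) (auto simp: eventually_conj_iff)
  have "same_order w (\<lambda>j. real j)"
    using w_linear w_pos by (simp add: same_order_iff_bigtheta less_imp_le)
  then obtain \<gamma> where \<gamma>: "\<gamma> > 0" and w_ge: "\<forall>\<^sub>F j in sequentially. \<gamma> * real j \<le> w j"
    unfolding same_order_def by (auto simp: eventually_conj_iff)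
  define b where "b = max (1 / 2) (2 - p)"
  have b: "0 < b" "b < 1" "1 - p \<le> b - 1"
    using p by (auto simp: b_def)
  \<comment> \<open>The first bound makes the threshold persistent, the second one gives the relative rate \<open>(b/2) / j\<close>.\<close>
  define \<delta> where "\<delta> = min (c / 2) (\<gamma> * b / 2)"
  define \<epsilon> where "\<epsilon> = (\<delta> / l) powr (1 / (p - 1))"
  have \<delta>: "0 < \<delta>" "2 * \<delta> \<le> c" "\<delta> / \<gamma> \<le> b / 2"
    using c \<gamma> b by (auto simp: \<delta>_def field_simps min_def)
  have \<epsilon>: "0 < \<epsilon>" "\<epsilon> powr (p - 1) = \<delta> / l"
    using \<delta> l_pos p by (auto simp: \<epsilon>_def powr_powr)
  have "\<forall>\<^sub>F j in sequentially. U j $ k < \<epsilon> * w j"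
  proof (rule subcritical_outside_blow_up_set[OF assms \<epsilon>(1) _ \<delta>(1)])
    show "\<forall>\<^sub>F j in sequentially. w j + 2 * \<delta> \<le> w (Suc j)"
      using c_incr by eventually_elim (use \<delta> in linarith)
  qed (simp add: \<epsilon>)
  then have "\<forall>\<^sub>F j in sequentially. U (Suc j) $ k
      \<le> (1 + (b / 2) / real j) * U j $ k + (C * \<gamma> powr (1 - p)) * real j powr (b - 1)"
    using w_ge eventually_gt_at_top[of "0::nat"]
  proof eventually_elim
    case (elim j)
    have j: "real j \<ge> 1" using elim by simp
    define r where "r = U j $ k / w j"
    have r: "0 \<le> r" "r \<le> \<epsilon>"
      using elim w_pos[of j] U_nonneg[of j k] by (auto simp: r_def field_simps)
    have "l * r powr p = l * r powr (p - 1) * r"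
      using r by (cases "r = 0") (auto simp: powr_diff)
    also have "\<dots> \<le> l * (\<delta> / l) * r"
      using r l_pos p unfolding \<epsilon>(2)[symmetric]
      by (intro mult_left_mono mult_right_mono powr_mono2) auto
    also have "\<dots> = \<delta> * U j $ k / w j"
      using l_pos by (simp add: r_def)
    also have "\<dots> \<le> \<delta> * U j $ k / (\<gamma> * real j)"
      using elim \<delta> \<gamma> U_nonneg[of j k] j by (intro divide_left_mono) (auto intro: mult_pos_pos w_pos)
    also have "\<dots> = (\<delta> / \<gamma>) * (U j $ k / real j)" by simp
    also have "\<dots> \<le> (b / 2) * (U j $ k / real j)"
      using \<delta> U_nonneg[of j k] by (intro mult_right_mono) auto
    finally have reaction: "l * r powr p \<le> (b / 2) * (U j $ k / real j)" .
    have "w j powr (1 - p) \<le> (\<gamma> * real j) powr (1 - p)"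
      using elim \<gamma> j p by (intro powr_mono2') auto
    also have "\<dots> = \<gamma> powr (1 - p) * real j powr (1 - p)"
      using \<gamma> by (simp add: powr_mult)
    also have "\<dots> \<le> \<gamma> powr (1 - p) * real j powr (b - 1)"
      using b j by (intro mult_left_mono powr_mono) auto
    finally have "C * w j powr (1 - p) \<le> C * \<gamma> powr (1 - p) * real j powr (b - 1)"
      using C(1) by simp
    then show ?case
      using C(2)[of j k] reaction by (simp add: r_def algebra_simps)
  qed
  then have "(\<lambda>j. U j $ k) \<in> O(\<lambda>j. real j powr b)"
    using C b U_nonneg by (intro bigo_by_subcritical_growth) auto
  then show thesis
    using b that by blast
qed

text \<open>The rate is of order at most \<open>j\<^bsup>b(p-1)-p\<^esup>\<close>, and \<open>b < 1\<close> makes the exponent smaller than \<open>-1\<close>.\<close>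

lemma summable_reaction_outside_blow_up_set:
  assumes "k \<notin> B"
  shows "summable (\<lambda>j. \<tau> j * U j $ k powr (p - 1))"
proof -
  obtain b where b: "0 < b" "b < 1" and O: "(\<lambda>j. U j $ k) \<in> O(\<lambda>j. real j powr b)"
    using assms by (rule sublinear_outside_blow_up_set)
  have "(\<lambda>j. \<bar>U j $ k\<bar> powr (p - 1)) \<in> O(\<lambda>j. \<bar>real j powr b\<bar> powr (p - 1))"
    using p by (intro bigo_powr O) auto
  then have "(\<lambda>j. U j $ k powr (p - 1)) \<in> O(\<lambda>j. real j powr (b * (p - 1)))"
    using U_nonneg by (simp add: powr_powr)
  then have "(\<lambda>j. \<tau> j * U j $ k powr (p - 1)) \<in> O(\<lambda>j. real j powr (- p) * real j powr (b * (p - 1)))"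
    using tau_order by (intro landau_o.big.mult) auto
  then have "(\<lambda>j. \<tau> j * U j $ k powr (p - 1)) \<in> O(\<lambda>j. real j powr (b * (p - 1) - p))"
    by (simp add: powr_add[symmetric] add.commute)
  moreover have "summable (\<lambda>j. norm (real j powr (b * (p - 1) - p)))"
  proof -
    have "b * (p - 1) < 1 * (p - 1)" using b p by (intro mult_strict_right_mono) auto
    then show ?thesis by (simp add: summable_real_powr_iff)
  qed
  ultimately show ?thesis
    by (rule summable_comparison_test_bigo[rotated])
qed

section \<open>Propagation along the graph\<close>

text \<open>At positive distance from the blow-up set the node's own reaction is absorbed by the Gronwall
  inequality, and the diagonal of \<open>A\<close> only removes mass; what remains is the inflow from the
  neighbours, which are at most one step closer. Beyond the critical
  distance \<open>growth\<close> is of constant order and the statement expresses boundedness, also for nodes that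
  cannot be joined to the blow-up set, where every \<open>n\<close> qualifies.\<close>

lemma upper_bound_by_distance:
  assumes "enat n \<le> graph_dist_set E k B"
  shows "(\<lambda>j. U j $ k) \<in> O(growth (1 - real n * (p - 1)))"
  using assms
proof (induction n arbitrary: k)
  case 0
  have "(\<lambda>j. U j $ k) \<in> O(w)" by (rule U_bigo_w)
  also have "w \<in> \<Theta>(\<lambda>j. real j)" by (rule w_linear)
  finally show ?case
    by (auto simp: growth_def)
next
  case (Suc n)
  define e where "e = 1 - real n * (p - 1)"
  define a where "a j = \<tau> j * U j $ k powr (p - 1)" for j
  define \<sigma> where "\<sigma> j = (\<Sum>i | (k, i) \<in> E. \<bar>A $ k $ i\<bar> / m $ k * U j $ i)" for j
  have k: "k \<notin> B" using Suc.prems by (rule notin_if_pos_graph_dist_set)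
  have e': "1 - real (Suc n) * (p - 1) = e - (p - 1)"
    by (simp add: e_def algebra_simps)
  \<comment> \<open>If \<open>e > 0\<close>, the inflow has order \<open>j\<^bsup>e1-1\<^esup>\<close> with \<open>e1 = e - (p - 1)\<close>. If \<open>e \<le> 0\<close>, then \<open>growth e\<close> may
     be logarithmic, and a small power of \<open>j\<close> is given away to absorb the logarithm; any \<open>e1\<close>
     strictly between \<open>1 - p\<close> and \<open>0\<close> serves, since \<open>growth e1\<close> is still of constant order.\<close>
  obtain e1 where e1: "(\<lambda>j. real j powr (- p) * growth e j) \<in> O(\<lambda>j. real j powr (e1 - 1))"
    and e1': "growth e1 \<in> O(growth (e - (p - 1)))"
  proof (cases "e > 0")
    case True
    have "(\<lambda>j. real j powr (- p) * growth e j) = (\<lambda>j. real j powr (e - (p - 1) - 1))"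
      using True by (auto simp: growth_def powr_add[symmetric] algebra_simps)
    then show thesis by (intro that[of "e - (p - 1)"]) auto
  next
    case False
    have "growth e \<in> O(\<lambda>j. real j powr ((p - 1) / 2))"
    proof (cases "e = 0")
      case True
      have "(\<lambda>j. ln (real j)) \<in> O(\<lambda>j. real j powr ((p - 1) / 2))" using p by real_asymp
      then show ?thesis using True by (simp add: growth_zero)
    next
      case ne: False
      have "growth e \<in> \<Theta>(\<lambda>_. 1)" using False ne by (intro growth_negative) auto
      also have "(\<lambda>_. 1) \<in> O(\<lambda>j. real j powr ((p - 1) / 2))" using p by real_asymp
      finally show ?thesis .
    qed
    then have "(\<lambda>j. real j powr (- p) * growth e j) \<in> O(\<lambda>j. real j powr (- p) * real j powr ((p - 1) / 2))"
      by (intro landau_o.big.mult_left)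
    also have "(\<lambda>j. real j powr (- p) * real j powr ((p - 1) / 2)) = (\<lambda>j. real j powr ((1 - p) / 2 - 1))"
      by (simp add: powr_add[symmetric] field_simps)
    finally have 1: "(\<lambda>j. real j powr (- p) * growth e j) \<in> O(\<lambda>j. real j powr ((1 - p) / 2 - 1))" .
    have "growth ((1 - p) / 2) \<in> \<Theta>(\<lambda>_. 1)"
      using p by (intro growth_negative) simp
    also have "(\<lambda>_. 1) \<in> \<Theta>(growth (e - (p - 1)))"
      using False p by (subst bigtheta_sym, intro growth_negative) simp
    finally have "growth ((1 - p) / 2) \<in> \<Theta>(growth (e - (p - 1)))" .
    then show thesis
      using 1 by (intro that[of "(1 - p) / 2"]) auto
  qed
  have "\<sigma> \<in> O(growth e)"
    unfolding \<sigma>_def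
  proof (intro big_sum_in_bigo)
    fix i assume i: "i \<in> {i. (k, i) \<in> E}"
    then have "enat n \<le> graph_dist_set E i B"
      using Suc.prems by (auto intro: graph_dist_set_neighbour)
    then have "(\<lambda>j. U j $ i) \<in> O(growth e)"
      unfolding e_def by (rule Suc.IH)
    then show "(\<lambda>j. \<bar>A $ k $ i\<bar> / m $ k * U j $ i) \<in> O(growth e)"
      using i m_pos[of k]
      by (subst landau_o.big.cmult_in_iff) (auto simp: node_edges_def)
  qed
  then have "(\<lambda>j. \<tau> j * \<sigma> j) \<in> O(\<lambda>j. real j powr (- p) * growth e j)"
    using tau_order by (intro landau_o.big.mult) auto
  also note e1
  also have "(\<lambda>j. real j powr (e1 - 1)) \<in> O(\<lambda>j. growth e1 (Suc j) - growth e1 j)"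
    using growth_increment[of e1] by (metis bigthetaD1 bigtheta_sym)
  finally obtain C where C: "C > 0"
    and ev: "\<forall>\<^sub>F j in sequentially. norm (\<tau> j * \<sigma> j) \<le> C * norm (growth e1 (Suc j) - growth e1 j)"
    by (rule landau_o.bigE)
  have "(\<lambda>j. U j $ k) \<in> O(growth e1)"
  proof (rule bigo_by_gronwall)
    show "\<forall>\<^sub>F j in sequentially. U (Suc j) $ k \<le> (1 + a j) * U j $ k + C * (growth e1 (Suc j) - growth e1 j)"
      using ev growth_mono[of e1]
    proof eventually_elim
      case (elim j)
      have "- (\<Sum>i\<in>UNIV. A $ k $ i * U j $ i) / m $ k = (\<Sum>i\<in>UNIV. - A $ k $ i / m $ k * U j $ i)"
        by (simp add: sum_negf sum_divide_distrib)
      also have "\<dots> \<le> (\<Sum>i\<in>UNIV. if (k, i) \<in> E then \<bar>A $ k $ i\<bar> / m $ k * U j $ i else 0)"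
      proof (rule sum_mono)
        fix i
        have "0 \<le> A $ i $ i" for i
          using admissible unfolding admissible_matrix_def by (meson less_imp_le)
        then show "- A $ k $ i / m $ k * U j $ i \<le> (if (k, i) \<in> E then \<bar>A $ k $ i\<bar> / m $ k * U j $ i else 0)"
          using m_pos[of k] U_nonneg[of j i]
            mult_right_mono[OF divide_right_mono[of "- A $ k $ i" "\<bar>A $ k $ i\<bar>" "m $ k"], of "U j $ i"]
          by (cases "k = i") (auto simp: node_edges_def)
      qed
      also have "\<dots> = \<sigma> j"
        by (simp add: \<sigma>_def sum.If_cases)
      finally have "\<tau> j * (- (\<Sum>i\<in>UNIV. A $ k $ i * U j $ i) / m $ k) \<le> \<tau> j * \<sigma> j"
        using tau_pos[of j] by (intro mult_left_mono) auto
      moreover have "\<tau> j * U j $ k powr p = a j * U j $ k"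
        using U_nonneg[of j k] by (cases "U j $ k = 0") (auto simp: a_def powr_diff)
      ultimately show ?case
        using elim by (simp add: U_step algebra_simps)
    qed
    show "summable a"
      unfolding a_def by (rule summable_reaction_outside_blow_up_set[OF k])
  qed (use C U_nonneg tau_pos growth_mono growth_ge_1 in \<open>auto simp: a_def less_imp_le\<close>)
  also note e1'
  finally show ?case by (simp only: e')
qed

text \<open>Keep only the inflow from the next node of the walk. The loss through the diagonal of \<open>A\<close> has a
  relative rate proportional to \<open>\<tau>\<^sub>j\<close>, which is summable because the blow-up time is finite. The
  restriction on \<open>n\<close> makes \<open>growth\<close> diverge, so that the inflow outweighs the initial data.\<close>

lemma lower_bound_by_walk:
  assumes "(k, y) \<in> E ^^ n" and "y \<in> B" and "real n * (p - 1) \<le> 1"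
  shows "(\<lambda>j. U j $ k) \<in> \<Omega>(growth (1 - real n * (p - 1)))"
  using assms
proof (induction n arbitrary: k)
  case 0
  then show ?case
    by (auto simp: mem_blow_up_set_iff growth_def)
next
  case (Suc n)
  obtain i where i: "(k, i) \<in> E" "(i, y) \<in> E ^^ n"
    using Suc.prems(1) by (meson relpow_Suc_D2)
  define e where "e = 1 - real n * (p - 1)"
  have e: "0 \<le> e - (p - 1)" "1 - real (Suc n) * (p - 1) = e - (p - 1)"
    using Suc.prems(3) by (auto simp: e_def algebra_simps)
  define e1 where "e1 = e - (p - 1)"
  define a where "a j = \<tau> j * (A $ k $ k / m $ k)" for j
  define c where "c = \<bar>A $ k $ i\<bar> / m $ k"
  have c: "c > 0" using i m_pos[of k] by (auto simp: c_def node_edges_def)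
  have "(\<lambda>j. U j $ i) \<in> \<Omega>(growth e)"
    unfolding e_def using i Suc e p by (intro Suc.IH) (auto simp: e_def)
  then have "(\<lambda>j. \<tau> j * (c * U j $ i)) \<in> \<Omega>(\<lambda>j. real j powr (- p) * growth e j)"
    using tau_order c by (intro landau_omega.big.mult) auto
  also have "(\<lambda>j. real j powr (- p) * growth e j) = (\<lambda>j. real j powr (e1 - 1))"
    using e p by (auto simp: growth_def powr_add[symmetric] algebra_simps e1_def)
  also have "(\<lambda>j. real j powr (e1 - 1)) \<in> \<Omega>(\<lambda>j. growth e1 (Suc j) - growth e1 j)"
    using growth_increment[of e1] by (metis bigthetaD2 bigtheta_sym)
  finally obtain \<kappa> where \<kappa>: "\<kappa> > 0"
    and ev: "\<forall>\<^sub>F j in sequentially. norm (\<tau> j * (c * U j $ i)) \<ge> \<kappa> * norm (growth e1 (Suc j) - growth e1 j)"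
    by (rule landau_omega.bigE)
  have "(\<lambda>j. U j $ k) \<in> \<Omega>(growth e1)"
  proof (rule bigomega_by_gronwall)
    show "\<forall>\<^sub>F j in sequentially. U (Suc j) $ k \<ge> (1 - a j) * U j $ k + \<kappa> * (growth e1 (Suc j) - growth e1 j)"
      using ev growth_mono[of e1]
    proof eventually_elim
      case (elim j)
      have offdiag: "A $ k $ h \<le> 0" if "h \<noteq> k" for h
        using admissible that unfolding admissible_matrix_def by metis
      have ik: "i \<noteq> k" using i by (auto simp: node_edges_def)
      have "(\<Sum>h\<in>UNIV. A $ k $ h * U j $ h)
          = A $ k $ k * U j $ k + (A $ k $ i * U j $ i + (\<Sum>h\<in>UNIV - {k} - {i}. A $ k $ h * U j $ h))"
        using ik by (simp add: sum.remove[of UNIV k] sum.remove[of "UNIV - {k}" i])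
      also have "\<dots> \<le> A $ k $ k * U j $ k + (A $ k $ i * U j $ i + 0)"
        using offdiag U_nonneg
        by (intro add_left_mono sum_nonpos mult_nonpos_nonneg) auto
      also have "\<dots> = A $ k $ k * U j $ k - \<bar>A $ k $ i\<bar> * U j $ i"
        using offdiag[OF ik] by simp
      finally have "(\<Sum>h\<in>UNIV. A $ k $ h * U j $ h) / m $ k
          \<le> (A $ k $ k * U j $ k - \<bar>A $ k $ i\<bar> * U j $ i) / m $ k"
        using m_pos[of k] by (intro divide_right_mono) auto
      also have "\<dots> = A $ k $ k / m $ k * U j $ k - c * U j $ i"
        by (simp add: c_def diff_divide_distrib)
      finally have "\<tau> j * ((\<Sum>h\<in>UNIV. A $ k $ h * U j $ h) / m $ k)
          \<le> \<tau> j * (A $ k $ k / m $ k * U j $ k - c * U j $ i)"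
        using tau_pos[of j] by (intro mult_left_mono) auto
      moreover have "0 \<le> \<tau> j * U j $ k powr p"
        using tau_pos[of j] by simp
      ultimately have "U (Suc j) $ k \<ge> (1 - a j) * U j $ k + \<tau> j * (c * U j $ i)"
        by (simp add: U_step a_def algebra_simps)
      moreover have "norm (\<tau> j * (c * U j $ i)) = \<tau> j * (c * U j $ i)"
        using tau_pos[of j] c U_nonneg[of j i] by simp
      ultimately show ?case using elim by simp
    qed
    show "summable a"
      unfolding a_def using blows_up
      by (intro summable_mult2) (auto simp: blows_up_at_def sums_iff)
    show "filterlim (growth e1) at_top sequentially"
      using e by (intro growth_at_top) (simp add: e1_def)
    have "0 < A $ k $ k" using admissible unfolding admissible_matrix_def by blast
    then show "0 \<le> a j" for j
      using tau_pos[of j] m_pos[of k] by (simp add: a_def)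
  qed (use \<kappa> U_nonneg growth_mono in auto)
  then show ?case by (simp only: e e1_def)
qed

lemma U_bigtheta_growth:
  assumes "graph_dist_set E k B = enat n" and "real n * (p - 1) \<le> 1"
  shows "(\<lambda>j. U j $ k) \<in> \<Theta>(growth (1 - real n * (p - 1)))"
proof -
  obtain y where "y \<in> B" "(k, y) \<in> E ^^ n"
    using assms(1) by (rule graph_dist_set_walk)
  then show ?thesis
    using assms by (intro bigthetaI upper_bound_by_distance lower_bound_by_walk) auto
qed

lemma U_at_top:
  assumes "graph_dist_set E k B = enat n" and "real n * (p - 1) \<le> 1"
  shows "filterlim (\<lambda>j. U j $ k) at_top sequentially"
proof -
  let ?g = "growth (1 - real n * (p - 1))"
  have "(\<lambda>j. U j $ k) \<in> \<Omega>(?g)" using U_bigtheta_growth[OF assms] by auto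
  then obtain c where c: "c > 0" "\<forall>\<^sub>F j in sequentially. norm (U j $ k) \<ge> c * norm (?g j)"
    by (rule landau_omega.bigE)
  have "filterlim (\<lambda>j. c * ?g j) at_top sequentially"
    using c(1) growth_at_top[of "1 - real n * (p - 1)"] assms(2)
    by (intro filterlim_tendsto_pos_mult_at_top[OF tendsto_const]) auto
  moreover have "\<forall>\<^sub>F j in sequentially. c * ?g j \<le> U j $ k"
    using c(2) growth_ge_1[of "1 - real n * (p - 1)"] by eventually_elim (use U_nonneg in auto)
  ultimately show ?thesis by (rule filterlim_at_top_mono)
qed

lemma U_not_at_top:
  assumes "enat n \<le> graph_dist_set E k B" and "1 < real n * (p - 1)"
  shows "\<not> filterlim (\<lambda>j. U j $ k) at_top sequentially"
proof
  assume top: "filterlim (\<lambda>j. U j $ k) at_top sequentially"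
  have "(\<lambda>j. U j $ k) \<in> O(growth (1 - real n * (p - 1)))"
    using assms(1) by (rule upper_bound_by_distance)
  also have "growth (1 - real n * (p - 1)) \<in> \<Theta>(\<lambda>_. 1)"
    using assms(2) by (intro growth_negative) auto
  finally obtain C where "\<forall>\<^sub>F j in sequentially. norm (U j $ k) \<le> C * norm (1 :: real)"
    by (rule landau_o.bigE)
  moreover have "\<forall>\<^sub>F j in sequentially. C + 1 \<le> U j $ k"
    using top by (simp add: filterlim_at_top)
  ultimately have "\<forall>\<^sub>F j in sequentially. False"
    by eventually_elim auto
  then show False by simp
qed

end

section \<open>Asymptotic behaviour at every node\<close>

theorem theorem2p3:
  fixes m :: "real ^ 'n" and A :: "real ^ 'n ^ 'n" and p l T :: real
    and U :: "nat \<Rightarrow> real ^ 'n" and K :: nat and d :: "'n \<Rightarrow> enat"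
  assumes "1 < p"
    and "\<And>k. 0 < m $ k"
    and "admissible_matrix A"
    and "explicit_solution m A p l U"
    and "blows_up_at m p l U T"
    and "(real K + 2) / (real K + 1) < p"
    and "K \<noteq> 0 \<Longrightarrow> p \<le> (real K + 1) / real K"
    and d_eq: "\<And>k. d k = graph_dist_set (node_edges A) k (blow_up_set m p l U T)"
  shows "\<forall>k. (filterlim (\<lambda>j. U j $ k) at_top sequentially \<longleftrightarrow> d k \<le> enat K)
    \<and> (\<forall>n. d k = enat n \<and> n \<le> K \<longrightarrow>
        (K = 0 \<or> p \<noteq> (real K + 1) / real K \<longrightarrow>
           same_order (\<lambda>j. U j $ k)
             (\<lambda>j. (T - time m p l U j) powr (- 1 / (p - 1) + real n)))
        \<and> (K \<noteq> 0 \<and> p = (real K + 1) / real K \<and> n = K \<longrightarrow>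
           same_order (\<lambda>j. U j $ k) (\<lambda>j. \<bar>ln (T - time m p l U j)\<bar>)))"
proof -
  interpret blow_up_solution m A p l T U
    by unfold_locales (use assms in auto)
  have above_K: "1 < real (Suc K) * (p - 1)"
    using assms(6) by (simp add: field_simps)
  have K_le: "real K * (p - 1) \<le> 1"
    using assms(7) by (cases "K = 0") (auto simp: field_simps)
  have below: "real n * (p - 1) \<le> 1" if "n \<le> K" for n
    using order_trans[OF mult_right_mono[of "real n" "real K" "p - 1"] K_le] that p by simp
  show ?thesis
  proof (intro allI conjI impI)
    fix k
    show "filterlim (\<lambda>j. U j $ k) at_top sequentially \<longleftrightarrow> d k \<le> enat K"
    proof
      assume top: "filterlim (\<lambda>j. U j $ k) at_top sequentially"
      show "d k \<le> enat K"
      proof (rule ccontr)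
        assume "\<not> d k \<le> enat K"
        then have "enat (Suc K) \<le> d k" by (simp add: Suc_ile_eq not_le)
        then show False
          using U_not_at_top[of "Suc K" k] above_K top d_eq by simp
      qed
    next
      assume "d k \<le> enat K"
      then obtain n where "d k = enat n" "n \<le> K"
        by (metis enat_ile enat_ord_simps(1))
      then show "filterlim (\<lambda>j. U j $ k) at_top sequentially"
        using U_at_top below d_eq by simp
    qed
  next
    fix k n
    assume n: "d k = enat n \<and> n \<le> K" and generic: "K = 0 \<or> p \<noteq> (real K + 1) / real K"
    define e where "e = 1 - real n * (p - 1)"
    have "real K * (p - 1) \<noteq> 1"
      using generic by (cases "K = 0") (auto simp: field_simps)
    then have "real K * (p - 1) < 1"
      using K_le by linarith
    moreover have "real n * (p - 1) \<le> real K * (p - 1)"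
      using n p by (intro mult_right_mono) auto
    ultimately have "0 < e"
      by (simp add: e_def)
    have "(\<lambda>j. U j $ k) \<in> \<Theta>(growth e)"
      unfolding e_def using n d_eq below by (intro U_bigtheta_growth) auto
    also have "growth e = (\<lambda>j. real j powr e)"
      using \<open>0 < e\<close> by (rule growth_pos)
    finally have "(\<lambda>j. U j $ k) \<in> \<Theta>(\<lambda>j. real j powr e)" .
    moreover have "(1 - p) * (- 1 / (p - 1) + real n) = e"
      using p by (simp add: e_def field_simps)
    ultimately show "same_order (\<lambda>j. U j $ k) (\<lambda>j. remaining j powr (- 1 / (p - 1) + real n))"
      using remaining_powr[of "- 1 / (p - 1) + real n"] by (subst same_order_U_iff) auto
  next
    fix k n
    assume n: "d k = enat n \<and> n \<le> K" and critical: "K \<noteq> 0 \<and> p = (real K + 1) / real K \<and> n = K"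
    have "1 - real n * (p - 1) = 0"
      using critical by (auto simp: field_simps)
    then have "(\<lambda>j. U j $ k) \<in> \<Theta>(growth 0)"
      using U_bigtheta_growth[of k n] n d_eq below by simp
    then show "same_order (\<lambda>j. U j $ k) (\<lambda>j. \<bar>ln (remaining j)\<bar>)"
      using ln_remaining by (subst same_order_U_iff) (auto simp: growth_zero)
  qed
qed

end
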